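(* Let $(X,d)$ be a metric space, let $\le$ be a quasi-order on $X$, and let $T:X\to X$ be a map such that $X(T,\le):=\{x\in X: x\le Tx\}$ is nonempty and $T$ is increasing (for all $x,y\in X$, $x\le y$ implies $Tx\le Ty$). Assume that: (1) $T$ is weakly conditional $(G,<>)$-contractive: there exists $\alpha\in(0,1)$ such that for all $x,y\in X$, if $x<>y$ and $\frac{1}{1+\alpha}\max\{d(x,Tx),d(y,Tx)\}\le d(x,y)$, then $d(Tx,Ty)\le \alpha\, d(x,y)$; (2) $d$ is ascending-orbital complete; (3) $\le$ is ascending-orbital-self-closed. Then $T$ is a Picard operator (modulo $\le$); that is: for each $x\in X(T,\le)$, the sequence $(T^nx)_{n\ge0}$ converges with respect to $d$, its limit $z$ satisfies $Tz=z$, and $T^nx\le z$ for all $n\ge 0$; and, moreover, whenever $z,w\in X$ satisfy $Tz=z$, $Tw=w$ and $z\le w$, one has $z=w$.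
   Context: A quasi-order is a reflexive and transitive relation (not necessarily antisymmetric). For $x,y\in X$, write $x<>y$ if $x\le y$ or $y\le x$. The function $G$ is $G(t)=1/(1+t)$, $t>0$. A sequence $(z_n)_{n\ge0}$ in $X$ is ascending if $z_i\le z_j$ whenever $i\le j$; it is orbital if there is $x\in X$ with $z_n=T^nx$ for all $n\ge0$. The metric $d$ is ascending-orbital complete if each sequence that is ascending, orbital and $d$-Cauchy converges in $(X,d)$. The quasi-order $\le$ is ascending-orbital-self-closed if, whenever $(z_n)_{n\ge 0}$ is an ascending orbital sequence and $z_n\to z$ with respect to $d$ for some $z\in X$, one has $z_n\le z$ for all $n$. *)

theory Defs
  imports "HOL-Analysis.Analysis"
begin

definition comparable :: "('a \<Rightarrow> 'a \<Rightarrow> bool) \<Rightarrow> 'a \<Rightarrow> 'a \<Rightarrow> bool" where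
  "comparable le x y \<longleftrightarrow> le x y \<or> le y x"

definition G :: "real \<Rightarrow> real" where
  "G t = 1 / (1 + t)" \<comment> \<open>intended for \<open>t > 0\<close>; only used on \<open>(0, 1)\<close>\<close>

definition weakly_conditional_contractive ::
    "(real \<Rightarrow> real) \<Rightarrow> ('a::metric_space \<Rightarrow> 'a \<Rightarrow> bool) \<Rightarrow> ('a \<Rightarrow> 'a) \<Rightarrow> bool" where
  "weakly_conditional_contractive H R T \<longleftrightarrow>
     (\<exists>\<alpha>. 0 < \<alpha> \<and> \<alpha> < 1 \<and>
        (\<forall>x y. R x y \<and> H \<alpha> * max (dist x (T x)) (dist y (T x)) \<le> dist x y
           \<longrightarrow> dist (T x) (T y) \<le> \<alpha> * dist x y))"

definition ascending :: "('a \<Rightarrow> 'a \<Rightarrow> bool) \<Rightarrow> (nat \<Rightarrow> 'a) \<Rightarrow> bool" where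
  "ascending le z \<longleftrightarrow> (\<forall>i j. i \<le> j \<longrightarrow> le (z i) (z j))"

definition orbital :: "('a \<Rightarrow> 'a) \<Rightarrow> (nat \<Rightarrow> 'a) \<Rightarrow> bool" where
  "orbital T z \<longleftrightarrow> (\<exists>x. \<forall>n. z n = (T ^^ n) x)"

definition ascending_orbital_complete ::
    "('a::metric_space \<Rightarrow> 'a \<Rightarrow> bool) \<Rightarrow> ('a \<Rightarrow> 'a) \<Rightarrow> bool" where
  "ascending_orbital_complete le T \<longleftrightarrow>
     (\<forall>z. ascending le z \<and> orbital T z \<and> Cauchy z \<longrightarrow> convergent z)"

definition ascending_orbital_self_closed ::
    "('a::metric_space \<Rightarrow> 'a \<Rightarrow> bool) \<Rightarrow> ('a \<Rightarrow> 'a) \<Rightarrow> bool" where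
  "ascending_orbital_self_closed le T \<longleftrightarrow>
     (\<forall>s z. ascending le s \<and> orbital T s \<and> s \<longlonglongrightarrow> z \<longrightarrow> (\<forall>n. le (s n) z))"

definition Picard_operator_modulo ::
    "('a::metric_space \<Rightarrow> 'a \<Rightarrow> bool) \<Rightarrow> ('a \<Rightarrow> 'a) \<Rightarrow> bool" where
  "Picard_operator_modulo le T \<longleftrightarrow>
     (\<forall>x. le x (T x) \<longrightarrow>
        (\<exists>z. (\<lambda>n. (T ^^ n) x) \<longlonglongrightarrow> z \<and> T z = z \<and> (\<forall>n. le ((T ^^ n) x) z))) \<and>
     (\<forall>z w. T z = z \<and> T w = w \<and> le z w \<longrightarrow> z = w)"

end

theory Submission
  imports Defs
begin

text \<open>
  Let \<open>\<alpha>\<close> be the contraction constant. Along an orbit \<open>s n = (T ^^ n) x\<close> with \<open>x \<le> T x\<close> the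
  contraction inequality holds for each pair of neighbours, since for \<open>y = T x\<close> its precondition
  reads \<open>dist x y \<le> (1 + \<alpha>) * dist x y\<close>. So the steps \<open>dist (s n) (s (Suc n))\<close> decay geometrically; the orbit is
  ascending and Cauchy, it has a limit \<open>z\<close>, and it lies below \<open>z\<close>.

  The point is that \<open>T z = z\<close>, although \<open>T\<close> need not be continuous. The contraction inequality
  for the pair \<open>(s n, z)\<close> would give \<open>dist (s (Suc n)) (T z) \<le> \<alpha> * dist (s n) z\<close>, and having this
  for infinitely many \<open>n\<close> forces \<open>s (Suc n)\<close> to approach \<open>T z\<close> as well as \<open>z\<close>. Hence it is enough
  that the precondition of the contraction inequality holds for infinitely many \<open>n\<close>. This no
  longer concerns \<open>T\<close>: it is the lemma \<open>frequently_step_and_next_remainder_le\<close> about the real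
  sequences of remainders \<open>dist (s n) z\<close> and of steps.

  Two comparable fixed points meet the precondition outright, and then coincide because
  \<open>\<alpha> < 1\<close>.
\<close>

text \<open>
  Suppose that the bound fails from some index on. A failure at \<open>n\<close> is of one of two kinds:
  either \<open>r (Suc n) > (1 + \<alpha>) * r n\<close> (the remainder grows), or \<open>\<rho> n > (1 + \<alpha>) * r n\<close> (the step is
  long). If no long step occurs, then \<open>r\<close> grows forever. If step \<open>n\<close> is long, then the triangle
  inequality makes \<open>r (Suc n)\<close> at least \<open>\<alpha> / (1 + \<alpha>) * \<rho> n\<close>; as all later steps have length at
  most \<open>\<alpha> * \<rho> n\<close>, none of them can be long, so from \<open>Suc n\<close> on the remainder grows. Either way
  \<open>r\<close> is eventually increasing and positive, and cannot tend to \<open>0\<close>.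
\<close>

lemma frequently_step_and_next_remainder_le:
  fixes r \<rho> :: "nat \<Rightarrow> real"
  assumes "0 < \<alpha>" "\<alpha> < 1"
    and r_nonneg: "\<And>n. 0 \<le> r n"
    and r_lim: "r \<longlonglongrightarrow> 0"
    and triangle: "\<And>n. \<rho> n \<le> r n + r (Suc n)"
    and step: "\<And>n. \<rho> (Suc n) \<le> \<alpha> * \<rho> n"
    and step_nonneg: "\<And>n. 0 \<le> \<rho> n"
  shows "\<exists>\<^sub>F n in sequentially. max (\<rho> n) (r (Suc n)) \<le> (1 + \<alpha>) * r n"
proof (rule ccontr)
  assume "\<not> ?thesis"
  then obtain N where fail:
    "\<And>n. n \<ge> N \<Longrightarrow> \<rho> n > (1 + \<alpha>) * r n \<or> r (Suc n) > (1 + \<alpha>) * r n"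
    by (auto simp: not_frequently eventually_sequentially not_le less_max_iff_disj)
  have "\<exists>k. \<forall>m\<ge>k. r (Suc m) > (1 + \<alpha>) * r m"
  proof (cases "\<exists>n\<ge>N. \<rho> n > (1 + \<alpha>) * r n")
    case False
    then show ?thesis using fail by blast
  next
    case True
    then obtain n where n: "n \<ge> N" and long: "\<rho> n > (1 + \<alpha>) * r n" by blast
    have later_steps: "\<rho> m \<le> \<alpha> * \<rho> n" if "m \<ge> Suc n" for m
      using that
    proof (induction m rule: dec_induct)
      case base
      show ?case by (rule step)
    next
      case (step m)
      have "\<rho> (Suc m) \<le> \<alpha> * \<rho> m" by (rule assms(6))
      also have "\<dots> \<le> 1 * \<rho> m"
        using assms(2) step_nonneg by (intro mult_right_mono) auto
      finally show ?case using step.IH by simp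
    qed
    have grow: "r (Suc m) > (1 + \<alpha>) * r m" if "m \<ge> Suc n" "\<alpha> * \<rho> n \<le> (1 + \<alpha>) * r m" for m
      using fail[of m] later_steps[of m] that n by linarith
    have "\<alpha> * \<rho> n \<le> (1 + \<alpha>) * r m" if "m \<ge> Suc n" for m
      using that
    proof (induction m rule: dec_induct)
      case base
      have "(1 + \<alpha>) * \<rho> n \<le> (1 + \<alpha>) * (r n + r (Suc n))"
        using triangle assms(1) by (intro mult_left_mono) auto
      with long show ?case by (simp add: algebra_simps)
    next
      case (step m)
      have "r m \<le> (1 + \<alpha>) * r m"
        using r_nonneg[of m] assms(1) by (simp add: algebra_simps)
      also have "\<dots> < r (Suc m)" using step by (intro grow) auto
      finally have "(1 + \<alpha>) * r m \<le> (1 + \<alpha>) * r (Suc m)"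
        using assms(1) by (intro mult_left_mono) auto
      with step.IH show ?case by linarith
    qed
    then show ?thesis using grow by blast
  qed
  then obtain k where k: "\<And>m. m \<ge> k \<Longrightarrow> r (Suc m) > (1 + \<alpha>) * r m" by blast
  have le_scaled: "r m \<le> (1 + \<alpha>) * r m" for m
    using r_nonneg[of m] assms(1) by (simp add: algebra_simps)
  \<comment> \<open>The remainder may vanish at \<open>k\<close> itself; the strict inequality makes it positive one later.\<close>
  have pos: "0 < r (Suc k)"
    using k[of k] le_scaled[of k] r_nonneg[of k] by linarith
  have "r (Suc k) \<le> r m" if "m \<ge> Suc k" for m
    using that
  proof (induction m rule: dec_induct)
    case (step m)
    then show ?case using k[of m] le_scaled[of m] by linarith
  qed simp
  then have "r (Suc k) \<le> 0"
    by (intro LIMSEQ_le_const[OF r_lim]) blast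
  with pos show False by simp
qed

lemma Cauchy_if_steps_contract:
  fixes s :: "nat \<Rightarrow> 'a::metric_space"
  assumes "0 \<le> \<alpha>" "\<alpha> < 1"
    and step: "\<And>n. dist (s (Suc n)) (s (Suc (Suc n))) \<le> \<alpha> * dist (s n) (s (Suc n))"
  shows "Cauchy s"
proof -
  define C where "C = dist (s 0) (s 1) / (1 - \<alpha>)"
  have geometric: "dist (s n) (s (Suc n)) \<le> \<alpha> ^ n * dist (s 0) (s 1)" for n
  proof (induction n)
    case (Suc n)
    have "dist (s (Suc n)) (s (Suc (Suc n))) \<le> \<alpha> * (\<alpha> ^ n * dist (s 0) (s 1))"
      using step[of n] mult_left_mono[OF Suc assms(1)] by linarith
    then show ?case by simp
  qed simp
  \<comment> \<open>The tail of the geometric series is \<open>C * \<alpha> ^ m\<close>; subtracting \<open>C * \<alpha> ^ n\<close> makes the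
     telescoping exact.\<close>
  have tail: "dist (s m) (s n) \<le> C * \<alpha> ^ m - C * \<alpha> ^ n" if "m \<le> n" for m n
    using that
  proof (induction n rule: dec_induct)
    case (step n)
    have "dist (s 0) (s 1) = C * (1 - \<alpha>)" using assms(2) by (simp add: C_def)
    with geometric[of n] have "dist (s n) (s (Suc n)) \<le> \<alpha> ^ n * (C * (1 - \<alpha>))"
      by metis
    then have "dist (s n) (s (Suc n)) \<le> C * \<alpha> ^ n - C * \<alpha> ^ Suc n"
      by (simp add: algebra_simps)
    then show ?case
      using step.IH dist_triangle[of "s m" "s (Suc n)" "s n"] by linarith
  qed simp
  have "C \<ge> 0" using assms(2) by (simp add: C_def)
  then have dist_le: "dist (s m) (s n) \<le> C * \<alpha> ^ m" if "m \<le> n" for m n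
    using tail[OF that] assms(1) by (smt (verit) mult_nonneg_nonneg zero_le_power)
  show ?thesis unfolding Cauchy_altdef
  proof (intro allI impI)
    fix e :: real assume "e > 0"
    have "(\<lambda>m. C * \<alpha> ^ m) \<longlonglongrightarrow> C * 0"
      using assms by (intro tendsto_mult_left LIMSEQ_power_zero) simp
    then have "\<forall>\<^sub>F m in sequentially. C * \<alpha> ^ m < e"
      using \<open>e > 0\<close> by (intro order_tendstoD(2)) auto
    then obtain M where M: "\<And>m. m \<ge> M \<Longrightarrow> C * \<alpha> ^ m < e"
      by (auto simp: eventually_sequentially)
    then show "\<exists>M. \<forall>m\<ge>M. \<forall>n>m. dist (s m) (s n) < e"
      using dist_le by (meson le_less_trans less_imp_le)
  qed
qed

lemma ascending_orbit:
  assumes "reflp le" "transp le" "monotone le le T" "le x (T x)"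
  shows "ascending le (\<lambda>n. (T ^^ n) x)"
  unfolding ascending_def
proof (intro allI impI)
  have next_le: "le ((T ^^ n) x) ((T ^^ Suc n) x)" for n
  proof (induction n)
    case (Suc n)
    then show ?case using monotoneD[OF assms(3)] by simp
  qed (use assms(4) in simp)
  fix i j :: nat assume "i \<le> j"
  then show "le ((T ^^ i) x) ((T ^^ j) x)"
  proof (induction j rule: dec_induct)
    case base
    show ?case using assms(1) by (rule reflpD)
  next
    case (step j)
    show ?case using assms(2) step.IH next_le by (rule transpD)
  qed
qed

theorem theorem5:
  fixes le :: "'a::metric_space \<Rightarrow> 'a \<Rightarrow> bool"
    and T :: "'a \<Rightarrow> 'a"
  assumes "reflp le" and "transp le"
    and "{x. le x (T x)} \<noteq> {}"
    and "monotone le le T"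
    and "weakly_conditional_contractive G (comparable le) T"
    and "ascending_orbital_complete le T"
    and "ascending_orbital_self_closed le T"
  shows "Picard_operator_modulo le T"
proof -
  obtain \<alpha> where \<alpha>: "0 < \<alpha>" "\<alpha> < 1" and contr_G:
    "\<And>x y. \<lbrakk>comparable le x y; G \<alpha> * max (dist x (T x)) (dist y (T x)) \<le> dist x y\<rbrakk>
       \<Longrightarrow> dist (T x) (T y) \<le> \<alpha> * dist x y"
    using assms(5) unfolding weakly_conditional_contractive_def by blast
  have contr: "dist (T x) (T y) \<le> \<alpha> * dist x y"
    if "le x y" "max (dist x (T x)) (dist y (T x)) \<le> (1 + \<alpha>) * dist x y" for x y
    using that \<alpha> by (intro contr_G) (auto simp: comparable_def G_def field_simps)
  have le_scaled: "dist x y \<le> (1 + \<alpha>) * dist x y" for x y :: 'a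
    using \<alpha> by (simp add: algebra_simps)
  have limit: "\<exists>z. (\<lambda>n. (T ^^ n) x) \<longlonglongrightarrow> z \<and> T z = z \<and> (\<forall>n. le ((T ^^ n) x) z)"
    if x: "le x (T x)" for x
  proof -
    define s where "s = (\<lambda>n. (T ^^ n) x)"
    have s_Suc: "s (Suc n) = T (s n)" for n by (simp add: s_def)
    have asc: "ascending le s"
      unfolding s_def using assms(1,2,4) x by (rule ascending_orbit)
    have orb: "orbital T s" by (auto simp: orbital_def s_def)
    have step: "dist (s (Suc n)) (s (Suc (Suc n))) \<le> \<alpha> * dist (s n) (s (Suc n))" for n
      using contr[of "s n" "s (Suc n)"] asc le_scaled[of "s n" "s (Suc n)"] \<alpha>
      by (simp add: ascending_def flip: s_Suc)
    have "Cauchy s"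
      using \<alpha> step by (intro Cauchy_if_steps_contract[of \<alpha>]) auto
    then obtain z where z: "s \<longlonglongrightarrow> z"
      using assms(6) asc orb unfolding ascending_orbital_complete_def convergent_def by blast
    have below: "le (s n) z" for n
      using assms(7) asc orb z unfolding ascending_orbital_self_closed_def by blast
    have r_lim: "(\<lambda>n. dist (s n) z) \<longlonglongrightarrow> 0"
      using z by (simp flip: tendsto_dist_iff)
    have "\<exists>\<^sub>F n in sequentially.
        max (dist (s n) (s (Suc n))) (dist (s (Suc n)) z) \<le> (1 + \<alpha>) * dist (s n) z"
      using \<alpha> r_lim step
      by (intro frequently_step_and_next_remainder_le) (auto intro: dist_triangle2)
    then have close: "\<exists>\<^sub>F n in sequentially. dist z (T z) \<le> dist (s (Suc n)) z + \<alpha> * dist (s n) z"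
    proof (rule frequently_elim1)
      fix n
      assume "max (dist (s n) (s (Suc n))) (dist (s (Suc n)) z) \<le> (1 + \<alpha>) * dist (s n) z"
      then have "dist (s (Suc n)) (T z) \<le> \<alpha> * dist (s n) z"
        using contr[OF below, of n] by (simp add: dist_commute s_Suc)
      then show "dist z (T z) \<le> dist (s (Suc n)) z + \<alpha> * dist (s n) z"
        using dist_triangle3[of z "T z" "s (Suc n)"] by linarith
    qed
    have "(\<lambda>n. dist (s (Suc n)) z + \<alpha> * dist (s n) z) \<longlonglongrightarrow> 0 + \<alpha> * 0"
      using r_lim by (intro tendsto_add tendsto_mult_left LIMSEQ_Suc)
    then have small: "\<forall>\<^sub>F n in sequentially. dist (s (Suc n)) z + \<alpha> * dist (s n) z < e"
      if "e > 0" for e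
      using that by (intro order_tendstoD(2)) auto
    have "T z = z"
    proof (rule ccontr)
      assume "T z \<noteq> z"
      then have "0 < dist z (T z)" by simp
      from small[OF this] close show False
        by (simp add: frequently_def not_le)
    qed
    with z below show ?thesis unfolding s_def by blast
  qed
  have unique: "z = w" if "T z = z" "T w = w" "le z w" for z w
  proof -
    have "dist z w \<le> \<alpha> * dist z w"
      using contr[of z w] that le_scaled[of z w] \<alpha> by (simp add: dist_commute)
    then have "(1 - \<alpha>) * dist z w \<le> 0" by (simp add: algebra_simps)
    with \<alpha> show ?thesis by (simp add: mult_le_0_iff)
  qed
  show ?thesis
    unfolding Picard_operator_modulo_def using limit unique by blast
qed

end
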